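(* Let $t$ be a complex number or an indeterminate, $F_j$ the Fibonacci numbers ($F_1=F_2=1$), and $I_{n,t}(x)=\prod_{i=1}^n\left(1+tx^{F_{i+1}}\right)$. Let $v_{2,t}(n)$ be the sum of the squares of the coefficients of $I_{n,t}(x)$ (as a polynomial in $x$). Then $$\sum_{n\ge0}v_{2,t}(n)x^n=\frac{1-(t^3+t)x^2}{1-(t^2+1)x-t(t^2+1)x^2+t(t^4+1)x^3}.$$ *)

theory Defs
  imports
    "HOL-Computational_Algebra.Computational_Algebra"
    "HOL-Number_Theory.Fib"
begin

definition fib_prod_poly :: "'a::comm_ring_1 \<Rightarrow> nat \<Rightarrow> 'a poly" where
  "fib_prod_poly t n = (\<Prod>i=1..n. 1 + monom t (fib (i + 1)))"

definition v2 :: "'a::comm_ring_1 \<Rightarrow> nat \<Rightarrow> 'a" where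
  "v2 t n = (\<Sum>k\<le>degree (fib_prod_poly t n). (coeff (fib_prod_poly t n) k)\<^sup>2)"

text \<open>
  The claimed generating function, as a formal power series. The denominator has constant
  term 1, so the division is genuine over any field.
\<close>

definition v2_gf :: "'a::field \<Rightarrow> 'a fps" where
  "v2_gf t =
     (1 - fps_const (t ^ 3 + t) * fps_X ^ 2) /
     (1 - fps_const (t ^ 2 + 1) * fps_X - fps_const (t * (t ^ 2 + 1)) * fps_X ^ 2
        + fps_const (t * (t ^ 4 + 1)) * fps_X ^ 3)"

text \<open>
  The indeterminate over the complex numbers. For this \<open>t\<close>, \<^term>\<open>fib_prod_poly t n\<close> is a
  polynomial in \<open>x\<close> over the ring of complex polynomials in \<open>t\<close>, and \<^term>\<open>v2 t n\<close> is a
  complex polynomial in \<open>t\<close>. Division of power series in \<open>x\<close> needs a coefficient field, so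
  coefficients are then embedded into the rational functions by \<^const>\<open>to_fract\<close>.
\<close>

abbreviation indet :: "complex poly" where
  "indet \<equiv> [:0, 1:]"

end

theory Submission
  imports Defs
begin

text \<open>
  Write \<open>I\<^sub>n\<close> for the product and \<open>\<langle>p, q\<rangle>\<close> for the sum of products of corresponding coefficients.
  Multiplication of both arguments by a power of \<open>x\<close> preserves this form, so with
  \<open>v\<^sub>n = \<langle>I\<^sub>n, I\<^sub>n\<rangle>\<close> and \<open>c\<^sub>n = \<langle>I\<^sub>n, x^F\<^sub>n\<^sub>+\<^sub>2 I\<^sub>n\<rangle>\<close> one gets \<open>v\<^sub>n\<^sub>+\<^sub>1 = (1 + t\<^sup>2) v\<^sub>n + 2 t c\<^sub>n\<close>.
  The degree of \<open>I\<^sub>n\<close> is less than \<open>F\<^sub>n\<^sub>+\<^sub>3\<close>; hence, on expanding the last two factors of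
  \<open>I\<^sub>n\<^sub>+\<^sub>2\<close> in \<open>c\<^sub>n\<^sub>+\<^sub>2\<close>, all large shifts drop out and \<open>c\<^sub>n\<^sub>+\<^sub>2 = t ((1 + t\<^sup>2) c\<^sub>n + t v\<^sub>n)\<close>.
  Eliminating \<open>c\<close> gives a linear recurrence of order three for \<open>v\<close>.
\<close>

text \<open>Cutting at \<open>degree p\<close> alone loses nothing, since later terms vanish
  whatever \<open>q\<close> is. The form is bilinear, without conjugation.\<close>

definition coeff_inner :: "'a::comm_ring_1 poly \<Rightarrow> 'a poly \<Rightarrow> 'a" where
  "coeff_inner p q = (\<Sum>k\<le>degree p. coeff p k * coeff q k)"

lemma coeff_inner_eq_sum:
  assumes "degree p \<le> N"
  shows "coeff_inner p q = (\<Sum>k\<le>N. coeff p k * coeff q k)"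
  unfolding coeff_inner_def
  by (rule sum.mono_neutral_left) (use assms in \<open>auto simp: coeff_eq_0\<close>)

lemma coeff_inner_commute: "coeff_inner p q = coeff_inner q p"
  by (simp add: coeff_inner_eq_sum[of p "max (degree p) (degree q)"]
      coeff_inner_eq_sum[of q "max (degree p) (degree q)"] mult.commute)

lemma coeff_inner_add_right: "coeff_inner p (q + r) = coeff_inner p q + coeff_inner p r"
  by (simp add: coeff_inner_def algebra_simps sum.distrib)

lemma coeff_inner_add_left: "coeff_inner (p + q) r = coeff_inner p r + coeff_inner q r"
  by (metis coeff_inner_add_right coeff_inner_commute)

lemma coeff_inner_smult_right: "coeff_inner p (smult c q) = c * coeff_inner p q"
  by (simp add: coeff_inner_def sum_distrib_left algebra_simps)

lemma coeff_inner_smult_left: "coeff_inner (smult c p) q = c * coeff_inner p q"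
  by (metis coeff_inner_smult_right coeff_inner_commute)

lemma coeff_inner_pCons: "coeff_inner (pCons a p) (pCons b q) = a * b + coeff_inner p q"
proof -
  have "coeff_inner (pCons a p) (pCons b q) =
      (\<Sum>k\<le>Suc (degree p). coeff (pCons a p) k * coeff (pCons b q) k)"
    by (rule coeff_inner_eq_sum) (rule degree_pCons_le)
  then show ?thesis
    by (simp add: sum.atMost_Suc_shift coeff_inner_def del: sum.atMost_Suc)
qed

lemma coeff_inner_monom_mult:
  "coeff_inner (monom 1 m * p) (monom 1 m * q) = coeff_inner p q"
  by (induction m) (simp_all add: monom_Suc coeff_inner_pCons)

lemma coeff_inner_monom_mult_right_eq_0:
  assumes "degree p < s"
  shows "coeff_inner p (monom 1 s * q) = 0"
  using assms by (simp add: coeff_inner_def coeff_monom_mult)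

lemma mult_one_plus_monom:
  fixes p :: "'a::comm_ring_1 poly"
  shows "p * (1 + monom t m) = p + smult t (monom 1 m * p)"
proof -
  have "monom t m = smult t (monom 1 m)"
    by (simp add: smult_monom)
  then show ?thesis
    by (simp add: distrib_left mult.commute)
qed

text \<open>Of the four terms of the expansion, the two diagonal ones agree after a common shift by
  \<open>m\<close> is cancelled. The cross terms move the relative shift to \<open>s - m\<close> and
  \<open>s + m\<close>.\<close>

lemma coeff_inner_shift_step:
  fixes p :: "'a::comm_ring_1 poly" and t :: 'a and m :: nat
  assumes "m \<le> s"
  defines "q \<equiv> p * (1 + monom t m)"
  shows "coeff_inner q (monom 1 s * q) =
    (1 + t\<^sup>2) * coeff_inner p (monom 1 s * p) + t * coeff_inner p (monom 1 (s - m) * p)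
      + t * coeff_inner p (monom 1 (s + m) * p)"
proof -
  have q: "q = p + smult t (monom 1 m * p)"
    unfolding q_def by (rule mult_one_plus_monom)
  have e1: "monom 1 s * (monom 1 m * p) = monom 1 (s + m) * p"
    by (simp add: mult.assoc[symmetric] mult_monom)
  have e2: "monom 1 s * p = monom 1 m * (monom 1 (s - m) * p)"
    using assms by (simp add: mult.assoc[symmetric] mult_monom)
  have e3: "coeff_inner (monom 1 m * p) (monom 1 (s + m) * p) = coeff_inner p (monom 1 s * p)"
    using coeff_inner_monom_mult[of m p "monom 1 s * p"]
    by (simp add: mult.assoc[symmetric] mult_monom add.commute)
  have e4: "coeff_inner (monom 1 m * p) (monom 1 s * p) = coeff_inner p (monom 1 (s - m) * p)"
    unfolding e2 by (rule coeff_inner_monom_mult)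
  have "monom 1 s * q = monom 1 s * p + smult t (monom 1 (s + m) * p)"
    by (simp add: q distrib_left e1)
  then have "coeff_inner q (monom 1 s * q) =
      coeff_inner (p + smult t (monom 1 m * p)) (monom 1 s * p + smult t (monom 1 (s + m) * p))"
    by (simp add: q)
  then show ?thesis
    by (simp add: coeff_inner_add_left coeff_inner_add_right coeff_inner_smult_left
        coeff_inner_smult_right e3[unfolded add.commute[of s m]] e4
        ring_distribs mult.assoc power2_eq_square add_ac)
qed

lemma coeff_inner_self_step:
  fixes p :: "'a::comm_ring_1 poly" and t :: 'a and m :: nat
  defines "q \<equiv> p * (1 + monom t m)"
  shows "coeff_inner q q =
    (1 + t\<^sup>2) * coeff_inner p p + 2 * t * coeff_inner p (monom 1 m * p)"
proof -
  have q: "q = p + smult t (monom 1 m * p)"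
    unfolding q_def by (rule mult_one_plus_monom)
  show ?thesis
    unfolding q
    by (simp add: coeff_inner_add_left coeff_inner_add_right coeff_inner_smult_left
        coeff_inner_smult_right coeff_inner_monom_mult coeff_inner_commute[of "monom 1 m * p" p]
        ring_distribs mult.assoc power2_eq_square add_ac)
qed

lemma fib_prod_poly_0: "fib_prod_poly t 0 = 1"
  by (simp add: fib_prod_poly_def)

lemma fib_prod_poly_Suc:
  "fib_prod_poly t (Suc n) = fib_prod_poly t n * (1 + monom t (fib (n + 2)))"
  by (simp add: fib_prod_poly_def)

lemma degree_fib_prod_poly_less: "degree (fib_prod_poly t n) < fib (n + 3)"
proof -
  \<comment> \<open>The exponents F_2, ..., F_{n+1} sum to F_{n+3} - 2; keeping the 2 lets the
    induction close by the Fibonacci recurrence.\<close>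
  have "degree (fib_prod_poly t n) + 2 \<le> fib (n + 3)"
  proof (induction n)
    case 0
    show ?case by (simp add: fib_prod_poly_0 numeral_eq_Suc)
  next
    case (Suc n)
    have "degree (1 + monom t (fib (n + 2))) \<le> fib (n + 2)"
      by (intro degree_add_le) (simp_all add: degree_monom_le)
    then have "degree (fib_prod_poly t (Suc n)) \<le> degree (fib_prod_poly t n) + fib (n + 2)"
      unfolding fib_prod_poly_Suc by (meson add_left_mono degree_mult_le order_trans)
    then show ?case using Suc by (simp add: numeral_eq_Suc)
  qed
  then show ?thesis by simp
qed

text \<open>The shift is the exponent of the next factor, so this is the cross term in passing from
  \<open>n\<close> to \<open>Suc n\<close>.\<close>

definition fib_corr :: "'a::comm_ring_1 \<Rightarrow> nat \<Rightarrow> 'a" where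
  "fib_corr t n = coeff_inner (fib_prod_poly t n) (monom 1 (fib (n + 2)) * fib_prod_poly t n)"

lemma v2_eq_coeff_inner: "v2 t n = coeff_inner (fib_prod_poly t n) (fib_prod_poly t n)"
  by (simp add: v2_def coeff_inner_def power2_eq_square)

lemma v2_Suc: "v2 t (Suc n) = (1 + t\<^sup>2) * v2 t n + 2 * t * fib_corr t n"
  by (simp only: v2_eq_coeff_inner fib_corr_def fib_prod_poly_Suc coeff_inner_self_step)

text \<open>Removing the last factor leaves shifts F_{n+3}, F_{n+4} and F_{n+1}; the first two
  exceed the degree.\<close>

lemma fib_corr_Suc:
  "fib_corr t (Suc n) =
    t * coeff_inner (fib_prod_poly t n) (monom 1 (fib (n + 1)) * fib_prod_poly t n)"
proof -
  have "fib (n + 2) \<le> fib (n + 3)" "fib (n + 3) - fib (n + 2) = fib (n + 1)"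
    by (simp_all add: numeral_eq_Suc)
  moreover have "degree (fib_prod_poly t n) < fib (n + 3)"
    by (rule degree_fib_prod_poly_less)
  ultimately show ?thesis
    using coeff_inner_shift_step[of "fib (n + 2)" "fib (n + 3)" "fib_prod_poly t n" t]
    by (simp add: fib_corr_def fib_prod_poly_Suc coeff_inner_monom_mult_right_eq_0
        add.commute[of 3] numeral_eq_Suc)
qed

text \<open>After \<open>fib_corr_Suc\<close> the shift equals the exponent of the last remaining
  factor, so \<open>s = m\<close>: the difference 0 gives \<open>v2 t n\<close>, and the doubled
  shift exceeds the degree.\<close>

lemma fib_corr_Suc_Suc:
  "fib_corr t (Suc (Suc n)) = t * ((1 + t\<^sup>2) * fib_corr t n + t * v2 t n)"
proof -
  have "fib (n + 3) \<le> fib (n + 2) + fib (n + 2)"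
    using fib_mono[of "n + 1" "n + 2"] by (simp add: numeral_eq_Suc)
  then have "degree (fib_prod_poly t n) < fib (n + 2) + fib (n + 2)"
    using degree_fib_prod_poly_less[of t n] by linarith
  then show ?thesis
    using coeff_inner_shift_step[of "fib (n + 2)" "fib (n + 2)" "fib_prod_poly t n" t]
    unfolding fib_corr_Suc[of t "Suc n"]
    by (simp add: fib_corr_def fib_prod_poly_Suc v2_eq_coeff_inner
        coeff_inner_monom_mult_right_eq_0)
qed

lemma fib_corr_0: "fib_corr t 0 = 0"
  by (simp add: fib_corr_def fib_prod_poly_0 coeff_inner_def numeral_eq_Suc)

lemma fib_corr_1: "fib_corr t 1 = 0"
  using fib_corr_Suc[of t 0]
  by (simp add: fib_prod_poly_0 coeff_inner_def)

lemma v2_0: "v2 t 0 = 1"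
  by (simp add: v2_def fib_prod_poly_0)

lemma v2_1: "v2 t 1 = 1 + t\<^sup>2"
  using v2_Suc[of t 0] by (simp add: v2_0 fib_corr_0)

lemma v2_2: "v2 t 2 = (1 + t\<^sup>2)\<^sup>2"
  using v2_Suc[of t 1] v2_1[of t] fib_corr_1[of t]
  by (simp add: numeral_2_eq_2)

lemma v2_recurrence:
  "v2 t (n + 3) =
    (t\<^sup>2 + 1) * v2 t (n + 2) + t * (t\<^sup>2 + 1) * v2 t (n + 1) - t * (t ^ 4 + 1) * v2 t n"
proof -
  have "v2 t (n + 3) = (1 + t\<^sup>2) * v2 t (n + 2) + 2 * t * fib_corr t (n + 2)"
    using v2_Suc[of t "n + 2"] by (simp add: numeral_eq_Suc)
  also have "fib_corr t (n + 2) = t * ((1 + t\<^sup>2) * fib_corr t n + t * v2 t n)"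
    using fib_corr_Suc_Suc[of t n] by simp
  \<comment> \<open>Grouping \<open>2 * t * fib_corr t n\<close> allows elimination by
    \<open>v2_Suc\<close> without dividing by \<open>2 * t\<close>.\<close>
  also have "2 * t * \<dots> = t * ((1 + t\<^sup>2) * (2 * t * fib_corr t n) + 2 * t\<^sup>2 * v2 t n)"
    by (simp add: algebra_simps power2_eq_square)
  also have "2 * t * fib_corr t n = v2 t (n + 1) - (1 + t\<^sup>2) * v2 t n"
    using v2_Suc[of t n] by simp
  finally show ?thesis
    by (simp add: algebra_simps power2_eq_square power4_eq_xxxx)
qed

text \<open>An arbitrary sequence \<open>f\<close> covers both \<open>v2 t\<close> itself and its
  image under \<open>to_fract\<close>. After clearing the denominator, coefficients 0, 1, 2 come
  from the initial values and the others vanish by the recurrence.\<close>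

lemma Abs_fps_eq_v2_gf:
  fixes t :: "'a::field" and f :: "nat \<Rightarrow> 'a"
  assumes "f 0 = 1" "f 1 = 1 + t\<^sup>2" "f 2 = (1 + t\<^sup>2)\<^sup>2"
    and rec: "\<And>n. f (n + 3) =
      (t\<^sup>2 + 1) * f (n + 2) + t * (t\<^sup>2 + 1) * f (n + 1) - t * (t ^ 4 + 1) * f n"
  shows "Abs_fps f = v2_gf t"
proof -
  let ?N = "1 - fps_const (t ^ 3 + t) * fps_X ^ 2 :: 'a fps"
  let ?D = "1 - fps_const (t ^ 2 + 1) * fps_X - fps_const (t * (t ^ 2 + 1)) * fps_X ^ 2
        + fps_const (t * (t ^ 4 + 1)) * fps_X ^ 3 :: 'a fps"
  have "fps_nth (Abs_fps f * ?D) n = fps_nth ?N n" for n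
  proof -
    have D: "Abs_fps f * ?D = Abs_fps f - fps_const (t ^ 2 + 1) * (fps_X * Abs_fps f)
        - fps_const (t * (t ^ 2 + 1)) * (fps_X ^ 2 * Abs_fps f)
        + fps_const (t * (t ^ 4 + 1)) * (fps_X ^ 3 * Abs_fps f)"
      by (simp only: ring_distribs mult_1_left mult_1_right mult_ac)
    consider "n = 0" | "n = 1" | "n = 2" | m where "n = m + 3"
      by (metis One_nat_def Suc_1 add.commute less_Suc_eq less_one nat_le_iff_add not_less
          numeral_3_eq_3)
    then show ?thesis
    proof cases
      case 3
      then show ?thesis
        using assms(1-3) unfolding D
        by (simp add: fps_X_power_mult_nth)
          (simp add: algebra_simps power2_eq_square power3_eq_cube)
    next
      case 4
      moreover have "m + 3 - 1 = m + 2" "m + 3 - 2 = m + 1"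
        by simp_all
      ultimately show ?thesis
        using rec[of m] unfolding D
        by (simp add: fps_X_power_mult_nth)
    qed (use assms(1-3) in \<open>simp_all add: D fps_X_power_mult_nth\<close>)
  qed
  then have "Abs_fps f * ?D = ?N"
    by (rule fps_ext)
  moreover have "fps_nth ?D 0 \<noteq> 0"
    by simp
  then have "?D \<noteq> 0"
    by (metis fps_zero_nth)
  ultimately show ?thesis
    unfolding v2_gf_def by (metis nonzero_mult_div_cancel_right)
qed

theorem theorem6:
  shows "(\<forall>t::complex. Abs_fps (\<lambda>n. v2 t n) = v2_gf t) \<and>
         Abs_fps (\<lambda>n. to_fract (v2 indet n)) = v2_gf (to_fract indet)"
proof (intro conjI allI)
  show "Abs_fps (\<lambda>n. v2 t n) = v2_gf t" for t :: complex
    by (rule Abs_fps_eq_v2_gf) (rule v2_0 v2_1 v2_2 v2_recurrence)+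
next
  \<comment> \<open>With powers preserved too, \<open>to_fract\<close> carries the initial values
    and the recurrence from polynomials to rational functions.\<close>
  have hom: "to_fract (p ^ k) = to_fract p ^ k" for p :: "complex poly" and k
    by (induction k) simp_all
  show "Abs_fps (\<lambda>n. to_fract (v2 indet n)) = v2_gf (to_fract indet)"
    by (rule Abs_fps_eq_v2_gf)
      (simp_all only: v2_0 v2_1 v2_2 v2_recurrence hom to_fract_add to_fract_diff
        to_fract_mult to_fract_1)
qed

end
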